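(* Let $G$ be a connected finite simple graph with $n$ vertices and maximum degree $\Delta(G)$, and fix an integer $r$ with $7\leq r\leq \Delta(G)+1$. Suppose $G$ is $(n-r+1)$-connected and $G$ does not contain the complete bipartite graph $K_{r-1,r-1}$ as a subgraph. Then $$\chi_{D_L}(G)\leq 2\Delta(G)-\Big(3\Big\lfloor\tfrac{\Delta(G)+1}{r}\Big\rfloor-2\Big).$$
   Context: A graph is $k$-connected if it has at least $k+1$ vertices and the removal of any $k-1$ or fewer vertices leaves a connected graph. A vertex coloring $f$ of a graph $G$ is distinguishing if the only automorphism $\phi$ of $G$ with $f(\phi(v))=f(v)$ for all vertices $v$ is the identity. A list assignment $L=\{L(v)\}_{v\in V(G)}$ assigns to each vertex a finite set of colors; $G$ is properly $L$-distinguishable if there is a proper vertex coloring $f$ of $G$ which is distinguishing and satisfies $f(v)\in L(v)$ for all $v$. The list-distinguishing chromatic number $\chi_{D_L}(G)$ is the minimum integer $k$ such that $G$ is properly $L$-distinguishable for every list assignment $L$ with $|L(v)|=k$ for all $v\in V(G)$. *)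

theory Defs
  imports "Graph_Theory.Graph_Theory"
begin

text \<open>
  A finite simple graph is a symmetric, loop-free digraph without parallel arcs on finitely many
  vertices, i.e. the locale \<open>graph\<close>; every undirected edge is a pair of opposite arcs, so the
  degree of a vertex is its out-degree.
\<close>

definition max_degree :: "('a, 'b) pre_digraph \<Rightarrow> nat" where
  "max_degree G = Max (out_degree G ` verts G)"

definition k_connected :: "nat \<Rightarrow> ('a, 'b) pre_digraph \<Rightarrow> bool" where
  "k_connected k G \<longleftrightarrow> k + 1 \<le> card (verts G) \<and>
     (\<forall>S \<subseteq> verts G. card S < k \<longrightarrow> connected (G \<restriction> (verts G - S)))"

definition automorphism :: "('a, 'b) pre_digraph \<Rightarrow> ('a \<Rightarrow> 'a) \<Rightarrow> bool" where
  "automorphism G \<phi> \<longleftrightarrow> bij_betw \<phi> (verts G) (verts G) \<and>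
     (\<forall>u \<in> verts G. \<forall>v \<in> verts G. \<phi> u \<rightarrow>\<^bsub>G\<^esub> \<phi> v \<longleftrightarrow> u \<rightarrow>\<^bsub>G\<^esub> v)"

definition proper_coloring :: "('a, 'b) pre_digraph \<Rightarrow> ('a \<Rightarrow> 'c) \<Rightarrow> bool" where
  "proper_coloring G f \<longleftrightarrow> (\<forall>u \<in> verts G. \<forall>v \<in> verts G. u \<rightarrow>\<^bsub>G\<^esub> v \<longrightarrow> f u \<noteq> f v)"

definition distinguishing :: "('a, 'b) pre_digraph \<Rightarrow> ('a \<Rightarrow> 'c) \<Rightarrow> bool" where
  "distinguishing G f \<longleftrightarrow>
     (\<forall>\<phi>. automorphism G \<phi> \<and> (\<forall>v \<in> verts G. f (\<phi> v) = f v) \<longrightarrow> (\<forall>v \<in> verts G. \<phi> v = v))"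

definition properly_list_distinguishable ::
    "('a, 'b) pre_digraph \<Rightarrow> ('a \<Rightarrow> 'c set) \<Rightarrow> bool" where
  "properly_list_distinguishable G L \<longleftrightarrow>
     (\<exists>f. proper_coloring G f \<and> distinguishing G f \<and> (\<forall>v \<in> verts G. f v \<in> L v))"

text \<open>
  Colors are natural numbers: a finite graph with finite lists involves only finitely many colors,
  so any infinite color type gives the same number. The requirement \<open>finite (L v)\<close> is
  not redundant for \<open>k = 0\<close>, since infinite sets have cardinality \<open>0\<close>. The minimum exists for a
  finite graph: lists of size \<open>card (verts G)\<close> admit an injective coloring.
\<close>

definition list_distinguishing_chromatic_number :: "('a, 'b) pre_digraph \<Rightarrow> nat" (\<open>\<chi>\<^sub>D\<^sub>L\<close>) where
  "\<chi>\<^sub>D\<^sub>L G = (LEAST k. \<forall>L :: 'a \<Rightarrow> nat set.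
     (\<forall>v \<in> verts G. finite (L v) \<and> card (L v) = k) \<longrightarrow> properly_list_distinguishable G L)"

end

theory Submission
  imports Defs
begin

text \<open>
  By \<open>k\<close>-connectivity every degree is at least \<open>n - r + 1\<close>, so \<open>n \<le> \<Delta> + r - 1\<close>. Lists of size \<open>n\<close>
  admit an injective coloring, hence \<open>\<chi>\<^sub>D\<^sub>L G \<le> n\<close>, and \<open>n\<close> is at most the claimed bound except when
  \<open>\<Delta> = r - 1\<close> and \<open>n = 2\<Delta>\<close>, where the bound is \<open>n - 1\<close>. In that case \<open>G\<close> is \<open>\<Delta>\<close>-regular. Lists of
  size \<open>n - 1\<close> which are not all equal still admit an injective coloring. If they are all equal, it
  suffices to repeat one color on two nonadjacent vertices with different neighborhoods. If there were
  no such pair, \<open>G\<close> would be complete multipartite with parts of size \<open>n - \<Delta> = \<Delta>\<close>, i.e. \<open>K\<^bsub>\<Delta>,\<Delta>\<^esub>\<close>.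
\<close>

section \<open>Systems of distinct representatives for lists of colors\<close>

lemma injective_choice:
  assumes "finite A" and "\<And>x. x \<in> A \<Longrightarrow> finite (L x) \<and> card A \<le> card (L x)"
  shows "\<exists>f. inj_on f A \<and> (\<forall>x \<in> A. f x \<in> L x)"
  using assms
proof (induction A rule: finite_induct)
  case empty
  then show ?case by simp
next
  case (insert a A)
  have "\<exists>f. inj_on f A \<and> (\<forall>x \<in> A. f x \<in> L x)"
    using insert by (intro insert.IH) (metis card_insert_disjoint insertCI Suc_leD)
  then obtain f where f: "inj_on f A" "\<forall>x \<in> A. f x \<in> L x" by blast
  \<comment> \<open>Greedy choice: the elements of \<open>A\<close> occupy at most
    \<open>card A\<close> colors, one fewer than \<open>a\<close> is guaranteed to have.\<close>
  have "card (f ` A) < card (L a)"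
    using insert.prems[of a] insert.hyps card_image_le[of A f] by simp
  then obtain c where c: "c \<in> L a" "c \<notin> f ` A"
    using insert.hyps by (metis card_mono finite_imageI not_le subsetI)
  have "inj_on (f(a := c)) (insert a A)"
    using f(1) c(2) insert.hyps by (auto simp: inj_on_def)
  moreover have "\<forall>x \<in> insert a A. (f(a := c)) x \<in> L x"
    using f(2) c(1) by auto
  ultimately show ?case by blast
qed

text \<open>The greedy choice would lack one color at the last element. Giving \<open>u\<close> a
  color \<open>c\<close> outside \<open>L v\<close> saves it: removing \<open>c\<close> from the
  other lists still leaves at least \<open>card A - 2\<close> colors for the
  \<open>card A - 2\<close> elements of \<open>B\<close>, and \<open>v\<close>, chosen last, has to
  avoid only the colors on \<open>B\<close>.\<close>

lemma injective_choice_unequal: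
  assumes A: "finite A"
    and L: "\<And>x. x \<in> A \<Longrightarrow> finite (L x) \<and> card (L x) = card A - 1"
    and uv: "u \<in> A" "v \<in> A" "L u \<noteq> L v"
  shows "\<exists>f. inj_on f A \<and> (\<forall>x \<in> A. f x \<in> L x)"
proof -
  \<comment> \<open>The lists are finite of equal size, so an inclusion would be an
    equality.\<close>
  have "\<not> L u \<subseteq> L v" using L[OF uv(1)] L[OF uv(2)] uv(3) card_subset_eq by metis
  then obtain c where c: "c \<in> L u" "c \<notin> L v" by blast
  define B where "B = A - {u, v}"
  have "u \<noteq> v" using uv by auto
  have B: "finite B" using A by (simp add: B_def)
  have AB: "A = insert u (insert v B)" using uv by (auto simp: B_def)
  have notin: "u \<notin> B" "v \<notin> B" by (auto simp: B_def)
  have cardB: "card A = card B + 2" using B notin \<open>u \<noteq> v\<close> unfolding AB by simp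
  have "\<exists>f. inj_on f B \<and> (\<forall>x \<in> B. f x \<in> L x - {c})"
  proof (rule injective_choice[OF B])
    fix x assume "x \<in> B"
    then have "finite (L x)" "card (L x) = card B + 1" using L[of x] cardB by (auto simp: B_def)
    then show "finite (L x - {c}) \<and> card B \<le> card (L x - {c})"
      by (simp add: card_Diff_singleton_if)
  qed
  then obtain f where f: "inj_on f B" "\<forall>x \<in> B. f x \<in> L x - {c}" by blast
  have "card (f ` B) < card (L v)"
    using L[OF uv(2)] cardB card_image_le[OF B, of f] by simp
  then obtain d where d: "d \<in> L v" "d \<notin> f ` B"
    using B by (metis card_mono finite_imageI not_le subsetI)
  have "c \<noteq> d" using c d by auto
  have "inj_on (f(u := c, v := d)) A"
    using f d \<open>c \<noteq> d\<close> \<open>u \<noteq> v\<close> notin unfolding AB by (auto simp: inj_on_def)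
  moreover have "\<forall>x \<in> A. (f(u := c, v := d)) x \<in> L x"
    using f d c unfolding AB by auto
  ultimately show ?thesis by blast
qed

context graph
begin

section \<open>Neighborhoods, degrees and connectivity\<close>

lemma not_dominates_self: "\<not> u \<rightarrow>\<^bsub>G\<^esub> u"
  using no_loops by (auto simp: arcs_ends_conv)

lemma finite_neighborhood: "finite {w. v \<rightarrow>\<^bsub>G\<^esub> w}"
  by (rule finite_subset[OF _ finite_verts]) (auto dest: adj_in_verts)

lemma out_degree_eq_card_neighborhood: "out_degree G v = card {w. v \<rightarrow>\<^bsub>G\<^esub> w}"
proof -
  have "bij_betw (head G) (out_arcs G v) {w. v \<rightarrow>\<^bsub>G\<^esub> w}"
  proof (rule bij_betwI')
    fix e e' assume "e \<in> out_arcs G v" "e' \<in> out_arcs G v"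
    then show "(head G e = head G e') = (e = e')"
      using no_multi_arcs[of e e'] by (auto simp: arc_to_ends_def)
  qed (auto simp: arcs_ends_conv)
  then show ?thesis unfolding out_degree_def by (rule bij_betw_same_card)
qed

lemma out_degree_le_max_degree: "v \<in> verts G \<Longrightarrow> out_degree G v \<le> max_degree G"
  unfolding max_degree_def by simp

text \<open>Deleting fewer than \<open>k\<close> neighbors of \<open>v\<close> cannot disconnect the
  graph, yet deleting all neighbors isolates \<open>v\<close>.\<close>

lemma k_connected_imp_le_out_degree:
  assumes "k_connected k G" and v: "v \<in> verts G"
  shows "k \<le> out_degree G v"
proof (rule ccontr)
  assume "\<not> k \<le> out_degree G v"
  define S where "S = {w. v \<rightarrow>\<^bsub>G\<^esub> w}"
  have S: "S \<subseteq> verts G" "card S < k"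
    using \<open>\<not> k \<le> out_degree G v\<close> unfolding S_def
    by (auto simp: out_degree_eq_card_neighborhood dest: adj_in_verts)
  define H where "H = G \<restriction> (verts G - S)"
  have con: "connected H" and k: "k + 1 \<le> card (verts G)"
    using assms S unfolding k_connected_def H_def by auto
  have "v \<notin> S" unfolding S_def using not_dominates_self by simp
  \<comment> \<open>\<open>v\<close> and its neighbors are at most \<open>k\<close> vertices, so
    some other vertex \<open>w\<close> survives the deletion.\<close>
  have "card (insert v S) < card (verts G)"
    using S(2) k finite_neighborhood[of v] \<open>v \<notin> S\<close> unfolding S_def by simp
  then obtain w where w: "w \<in> verts G" "w \<noteq> v" "w \<notin> S"
    using S(1) v by (metis card_mono finite_insert finite_subset finite_verts insertCI not_le subsetI)
  \<comment> \<open>The first step of a path from \<open>v\<close> to \<open>w\<close> leads to a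
    surviving neighbor of \<open>v\<close>, which is impossible.\<close>
  have "(v, w) \<in> rtrancl_on (verts H) ((arcs_ends H)\<^sup>s)"
    using con v w \<open>v \<notin> S\<close> unfolding connected_conv by (simp add: H_def)
  then obtain x where "(v, x) \<in> (arcs_ends H)\<^sup>s"
    using w(2) by (cases rule: converse_rtrancl_on_cases) auto
  then have "v \<rightarrow>\<^bsub>H\<^esub> x \<or> x \<rightarrow>\<^bsub>H\<^esub> v" by (auto simp: symcl_def)
  then have "v \<rightarrow>\<^bsub>G\<^esub> x" "x \<notin> S"
    unfolding H_def arcs_ends_conv using graph_symmetric[unfolded arcs_ends_conv] by auto
  then show False unfolding S_def by simp
qed

section \<open>Distinguishing colorings with at most one repeated color\<close>

lemma injective_coloring_imp_properly_list_distinguishable: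
  assumes "inj_on f (verts G)" and "\<forall>v \<in> verts G. f v \<in> L v"
  shows "properly_list_distinguishable G L"
proof -
  have "proper_coloring G f"
    using assms(1) not_dominates_self unfolding proper_coloring_def by (metis inj_onD)
  moreover have "distinguishing G f"
    using assms(1) unfolding distinguishing_def automorphism_def
    by (metis bij_betwE inj_onD)
  ultimately show ?thesis using assms(2) unfolding properly_list_distinguishable_def by blast
qed

lemma list_distinguishing_chromatic_number_le:
  assumes "\<And>L :: 'a \<Rightarrow> nat set. (\<And>v. v \<in> verts G \<Longrightarrow> finite (L v) \<and> card (L v) = k)
    \<Longrightarrow> properly_list_distinguishable G L"
  shows "\<chi>\<^sub>D\<^sub>L G \<le> k"
  unfolding list_distinguishing_chromatic_number_def by (rule Least_le) (use assms in blast)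

lemma list_distinguishing_chromatic_number_le_card: "\<chi>\<^sub>D\<^sub>L G \<le> card (verts G)"
proof (rule list_distinguishing_chromatic_number_le)
  fix L :: "'a \<Rightarrow> nat set"
  assume "\<And>v. v \<in> verts G \<Longrightarrow> finite (L v) \<and> card (L v) = card (verts G)"
  then have "\<exists>f. inj_on f (verts G) \<and> (\<forall>v \<in> verts G. f v \<in> L v)"
    by (intro injective_choice) auto
  then show "properly_list_distinguishable G L"
    using injective_coloring_imp_properly_list_distinguishable by blast
qed

text \<open>Only \<open>u\<close> and \<open>v\<close> share a color, so a color-preserving
  automorphism other than the identity exchanges them and fixes everything else. Such an exchange
  would force their neighborhoods to agree.\<close>

lemma distinguishing_if_one_repeated_color:
  assumes uv: "u \<in> verts G" "v \<in> verts G" "\<not> u \<rightarrow>\<^bsub>G\<^esub> v"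
    and twins: "{w. u \<rightarrow>\<^bsub>G\<^esub> w} \<noteq> {w. v \<rightarrow>\<^bsub>G\<^esub> w}"
    and inj: "inj_on f (verts G - {v})" and fv: "f v = f u"
  shows "proper_coloring G f" and "distinguishing G f"
proof -
  have "u \<noteq> v" using twins by auto
  have eqD: "x = y \<or> (x = u \<and> y = v) \<or> (x = v \<and> y = u)"
    if "f x = f y" "x \<in> verts G" "y \<in> verts G" for x y
  proof -
    have "x = y" if "x \<noteq> v" "y \<noteq> v"
      using inj_onD[OF inj \<open>f x = f y\<close>] that \<open>x \<in> verts G\<close> \<open>y \<in> verts G\<close> by simp
    moreover have "y = u" if "x = v" "y \<noteq> v"
      using inj_onD[OF inj, of y u] that \<open>f x = f y\<close> \<open>y \<in> verts G\<close> uv fv \<open>u \<noteq> v\<close> by simp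
    moreover have "x = u" if "y = v" "x \<noteq> v"
      using inj_onD[OF inj, of x u] that \<open>f x = f y\<close> \<open>x \<in> verts G\<close> uv fv \<open>u \<noteq> v\<close> by simp
    ultimately show ?thesis by blast
  qed
  show "proper_coloring G f"
    unfolding proper_coloring_def
    using eqD uv(3) not_dominates_self graph_symmetric by metis
  show "distinguishing G f"
    unfolding distinguishing_def
  proof (intro allI impI ballI)
    fix \<phi> x
    assume "automorphism G \<phi> \<and> (\<forall>v \<in> verts G. f (\<phi> v) = f v)" and x: "x \<in> verts G"
    then have bij: "bij_betw \<phi> (verts G) (verts G)"
      and adj: "\<And>y z. y \<in> verts G \<Longrightarrow> z \<in> verts G \<Longrightarrow> \<phi> y \<rightarrow>\<^bsub>G\<^esub> \<phi> z \<longleftrightarrow> y \<rightarrow>\<^bsub>G\<^esub> z"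
      and col: "\<And>y. y \<in> verts G \<Longrightarrow> f (\<phi> y) = f y"
      unfolding automorphism_def by auto
    have range: "\<phi> y \<in> verts G" if "y \<in> verts G" for y using bij that by (rule bij_betw_apply)
    have phi: "\<phi> y = y \<or> (y = u \<and> \<phi> y = v) \<or> (y = v \<and> \<phi> y = u)" if "y \<in> verts G" for y
      using eqD[OF col range] that by metis
    have injphi: "y = z" if "\<phi> y = \<phi> z" "y \<in> verts G" "z \<in> verts G" for y z
      using bij that by (metis bij_betw_imp_inj_on inj_onD)
    have "\<phi> u \<noteq> v"
    proof
      assume "\<phi> u = v"
      have "u \<rightarrow>\<^bsub>G\<^esub> w \<longleftrightarrow> v \<rightarrow>\<^bsub>G\<^esub> w" if w: "w \<in> verts G" for w
      \<comment> \<open>On \<open>u\<close> and \<open>v\<close> themselves both sides are false, as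
        the two vertices are nonadjacent and there are no loops.\<close>
      proof (cases "w = u \<or> w = v")
        case True
        then show ?thesis using uv(3) not_dominates_self graph_symmetric by metis
      next
        case False
        then have "\<phi> w = w" using phi[OF w] by blast
        then show ?thesis using adj[OF uv(1) w] \<open>\<phi> u = v\<close> by simp
      qed
      then have "{w. u \<rightarrow>\<^bsub>G\<^esub> w} = {w. v \<rightarrow>\<^bsub>G\<^esub> w}" using adj_in_verts by blast
      with twins show False by simp
    qed
    then show "\<phi> x = x" using phi[OF x] phi[OF uv(1)] injphi x uv by metis
  qed
qed

text \<open>The non-neighbors of \<open>u\<close> (including \<open>u\<close>) all have the
  neighborhood \<open>B\<close> of \<open>u\<close>. So each vertex of \<open>B\<close> sees all of
  \<open>A\<close>, and its degree \<open>d = card A\<close> leaves no room for further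
  neighbors.\<close>

lemma complete_bipartite_if_nonadjacent_twins:
  assumes reg: "\<And>v. v \<in> verts G \<Longrightarrow> out_degree G v = d"
    and n: "card (verts G) = 2 * d" "0 < d"
    and twins: "\<And>u v. u \<in> verts G \<Longrightarrow> v \<in> verts G \<Longrightarrow> \<not> u \<rightarrow>\<^bsub>G\<^esub> v
      \<Longrightarrow> {w. u \<rightarrow>\<^bsub>G\<^esub> w} = {w. v \<rightarrow>\<^bsub>G\<^esub> w}"
  shows "complete_bipartite_digraph d d G"
proof -
  obtain u where u: "u \<in> verts G" using n by fastforce
  define B where "B = {w. u \<rightarrow>\<^bsub>G\<^esub> w}"
  define A where "A = verts G - B"
  have B: "B \<subseteq> verts G" "finite B" "card B = d"
    unfolding B_def using reg[OF u] finite_neighborhood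
    by (auto simp: out_degree_eq_card_neighborhood dest: adj_in_verts)
  have A: "finite A" "card A = d"
    unfolding A_def using n B by (simp_all add: card_Diff_subset)
  have NA: "{w. a \<rightarrow>\<^bsub>G\<^esub> w} = B" if "a \<in> A" for a
    using twins[OF u, of a] that unfolding A_def B_def by auto
  have NB: "{w. b \<rightarrow>\<^bsub>G\<^esub> w} = A" if b: "b \<in> B" for b
  proof -
    have "A \<subseteq> {w. b \<rightarrow>\<^bsub>G\<^esub> w}" using NA b graph_symmetric by blast
    moreover have "card {w. b \<rightarrow>\<^bsub>G\<^esub> w} = card A"
      using reg[of b] b B(1) A(2) by (auto simp: out_degree_eq_card_neighborhood)
    ultimately show ?thesis using card_subset_eq[OF finite_neighborhood] by metis
  qed
  have "arcs_ends G = A \<times> B \<union> B \<times> A"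
  proof (intro subset_antisym subrelI)
    fix x y assume xy: "x \<rightarrow>\<^bsub>G\<^esub> y"
    then have "x \<in> A \<or> x \<in> B" using adj_in_verts(1) unfolding A_def by blast
    then show "(x, y) \<in> A \<times> B \<union> B \<times> A" using NA NB xy by blast
  next
    fix x y assume "(x, y) \<in> A \<times> B \<union> B \<times> A"
    then show "x \<rightarrow>\<^bsub>G\<^esub> y" using NA NB by blast
  qed
  moreover have "verts G = A \<union> B" "A \<inter> B = {}" unfolding A_def using B by auto
  moreover have "graph G" by unfold_locales
  ultimately show ?thesis using A(2) B(3) unfolding complete_bipartite_digraph_def by blast
qed

lemma list_distinguishing_chromatic_number_le_card_minus_one:
  assumes uv: "u \<in> verts G" "v \<in> verts G" "\<not> u \<rightarrow>\<^bsub>G\<^esub> v"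
    and twins: "{w. u \<rightarrow>\<^bsub>G\<^esub> w} \<noteq> {w. v \<rightarrow>\<^bsub>G\<^esub> w}"
  shows "\<chi>\<^sub>D\<^sub>L G \<le> card (verts G) - 1"
proof (rule list_distinguishing_chromatic_number_le)
  fix L :: "'a \<Rightarrow> nat set"
  assume L: "\<And>v. v \<in> verts G \<Longrightarrow> finite (L v) \<and> card (L v) = card (verts G) - 1"
  show "properly_list_distinguishable G L"
  proof (cases "\<exists>x \<in> verts G. \<exists>y \<in> verts G. L x \<noteq> L y")
    case True
    then obtain x y where "x \<in> verts G" "y \<in> verts G" "L x \<noteq> L y" by blast
    then have "\<exists>f. inj_on f (verts G) \<and> (\<forall>v \<in> verts G. f v \<in> L v)"
      by (intro injective_choice_unequal[where L = L and u = x and v = y] finite_verts L)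
    then show ?thesis using injective_coloring_imp_properly_list_distinguishable by blast
  next
    case False
    have "u \<noteq> v" using twins by auto
    \<comment> \<open>All lists coincide here. Without \<open>v\<close> there are exactly as many
      vertices as colors in a list, and \<open>v\<close> can reuse the color of
      \<open>u\<close>.\<close>
    have "\<exists>f. inj_on f (verts G - {v}) \<and> (\<forall>x \<in> verts G - {v}. f x \<in> L x)"
      using L uv by (intro injective_choice) auto
    then obtain f where f: "inj_on f (verts G - {v})" "\<forall>x \<in> verts G - {v}. f x \<in> L x" by blast
    define g where "g = f(v := f u)"
    have "inj_on g (verts G - {v})" using f(1) by (auto simp: g_def inj_on_def)
    moreover have "g v = g u" by (simp add: g_def)
    ultimately have "proper_coloring G g" "distinguishing G g"
      using distinguishing_if_one_repeated_color[OF uv twins] by blast+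
    moreover have "L v = L u" and "f u \<in> L u" using False f(2) uv \<open>u \<noteq> v\<close> by blast+
    then have "\<forall>x \<in> verts G. g x \<in> L x" using f(2) by (simp add: g_def)
    ultimately show ?thesis unfolding properly_list_distinguishable_def by blast
  qed
qed

end

text \<open>If the quotient is 1, the bound is \<open>2 * d - 1\<close>, while
  \<open>n \<le> d + r - 1 \<le> 2 * d\<close>, with equality throughout only for
  \<open>r = d + 1\<close>. If it is \<open>j + 2\<close>, then
  \<open>d + 1 \<ge> 2 * r + 7 * j\<close> makes \<open>d\<close> large enough to absorb the
  subtracted \<open>3 * j + 4\<close>.\<close>

lemma bound_cases:
  fixes n r d :: nat
  assumes "7 \<le> r" and "r \<le> d + 1" and "n \<le> d + r - 1"
  shows "int n \<le> 2 * int d - (3 * int ((d + 1) div r) - 2) \<or> (d + 1 = r \<and> n = 2 * d)"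
proof -
  define m where "m = (d + 1) div r"
  define s where "s = (d + 1) mod r"
  have ds: "d + 1 = r * m + s" unfolding m_def s_def by simp
  have "1 \<le> m" using assms div_le_mono[of r "d + 1" r] unfolding m_def by simp
  show ?thesis
  proof (cases "m = 1")
    case True
    then show ?thesis using ds assms unfolding m_def[symmetric] by auto
  next
    case False
    then have "2 \<le> m" using \<open>1 \<le> m\<close> by simp
    then obtain j where j: "m = j + 2" using le_Suc_ex by (metis add.commute)
    have "7 * j \<le> r * j" using assms by simp
    moreover have "d + 1 = 2 * r + r * j + s" using ds j by (simp add: algebra_simps)
    ultimately have "2 * r + 7 * j \<le> d + 1" by linarith
    then show ?thesis using assms j unfolding m_def[symmetric] by auto
  qed
qed

theorem theorem4p3:
  fixes G :: "('a, 'b) pre_digraph" and r :: nat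
  assumes "graph G"
    and "connected G"
    and "7 \<le> r" and "r \<le> max_degree G + 1"
    and "k_connected (card (verts G) - r + 1) G"
    and "\<not> (\<exists>H. subgraph H G \<and> complete_bipartite_digraph (r - 1) (r - 1) H)"
  shows "int (\<chi>\<^sub>D\<^sub>L G)
    \<le> 2 * int (max_degree G) - (3 * int ((max_degree G + 1) div r) - 2)"
proof -
  interpret graph G by fact
  define n where "n = card (verts G)"
  define d where "d = max_degree G"
  have deg: "n - r + 1 \<le> out_degree G v" "out_degree G v \<le> d" if "v \<in> verts G" for v
    using k_connected_imp_le_out_degree[OF assms(5) that] out_degree_le_max_degree[OF that]
    by (simp_all add: n_def d_def)
  have "verts G \<noteq> {}" using assms(5) unfolding k_connected_def by auto
  then obtain v where "v \<in> verts G" by blast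
  from deg[OF this] have n: "n \<le> d + r - 1" using assms(3) by linarith
  have le_n: "\<chi>\<^sub>D\<^sub>L G \<le> n" unfolding n_def by (rule list_distinguishing_chromatic_number_le_card)
  from bound_cases[OF assms(3) assms(4)[folded d_def] n]
  consider (large) "int n \<le> 2 * int d - (3 * int ((d + 1) div r) - 2)"
    | (tight) "d + 1 = r" "n = 2 * d" by blast
  then show ?thesis
  proof cases
    case large
    then show ?thesis using le_n unfolding d_def by linarith
  next
    case tight
    \<comment> \<open>Here \<open>n - r + 1 = d\<close>, so the lower and upper bounds on the degree
      meet.\<close>
    have "out_degree G v = d" if "v \<in> verts G" for v
      using deg[OF that] tight assms(3) by linarith
    moreover have "\<not> complete_bipartite_digraph d d G"
      using assms(6) subgraph_refl tight(1) by auto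
    ultimately obtain u v where "u \<in> verts G" "v \<in> verts G" "\<not> u \<rightarrow>\<^bsub>G\<^esub> v"
      "{w. u \<rightarrow>\<^bsub>G\<^esub> w} \<noteq> {w. v \<rightarrow>\<^bsub>G\<^esub> w}"
      using complete_bipartite_if_nonadjacent_twins[of d] tight assms(3) unfolding n_def by fastforce
    then have "\<chi>\<^sub>D\<^sub>L G \<le> n - 1"
      unfolding n_def by (rule list_distinguishing_chromatic_number_le_card_minus_one)
    \<comment> \<open>Hence the claimed bound is \<open>2 * d - 1 = n - 1\<close>.\<close>
    moreover have "(d + 1) div r = 1" using tight assms(3) by simp
    ultimately show ?thesis using tight assms(3) unfolding d_def[symmetric] by linarith
  qed
qed

end
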